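(* Let $\mathcal X=\{x\in\mathbb R^n: l_j\le x_j\le u_j,\ j=1,\dots,n\}$ be a box, let $\hat f:\mathcal X\to\mathbb R$ be (the restriction to $\mathcal X$ of) an input convex neural network, and let $\{\tilde x^i\}_{i=1}^{2^n}$ be the vertices of $\mathcal X$. Then the concave envelope of $\hat f$ over $\mathcal X$ is the value function $x\mapsto\bar z(x)$, $x\in\mathcal X$, of the linear program $$\bar z(x)=\max_{\alpha\in\mathbb R^{2^n},\ \bar z\in\mathbb R}\ \bar z\quad\text{s.t.}\quad \sum_{i=1}^{2^n}\alpha_i\tilde x^i=x,\quad \sum_{i=1}^{2^n}\alpha_i=1,\quad \bar z=\sum_{i=1}^{2^n}\alpha_i\hat f(\tilde x^i),\quad \alpha_i\ge 0\ (i=1,\dots,2^n).$$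
   Context: Input convex neural network (ICNN). Let $K\ge 1$, with layer widths $n_0=n,n_1,\dots,n_{K-1},n_K=1$. Parameters: real matrices $W_k\in\mathbb R^{n_{k+1}\times n_k}$, $S_k\in\mathbb R^{n_{k+1}\times n}$ and vectors $b_k\in\mathbb R^{n_{k+1}}$, $k=0,\dots,K-1$, with $W_0=0$ by convention and all entries of $W_1,\dots,W_{K-1}$ non-negative ($S_k,b_k$ unrestricted in sign). The network output on input $z_0\in\mathbb R^n$ is $\hat f(z_0)=z_K$, where $$z_{k+1}=\max\{0,\,W_kz_k+S_kz_0+b_k\}\ \text{(componentwise)},\ k=0,\dots,K-2,\qquad z_K=W_{K-1}z_{K-1}+S_{K-1}z_0+b_{K-1}.$$ Vertices. The box has real bounds $l_j\le u_j$. The points $\tilde x^1,\dots,\tilde x^{2^n}$ are those obtained from all $2^n$ combinations of choosing, for each coordinate $j$, either the lower bound $l_j$ or the upper bound $u_j$. Concave envelope. The concave envelope of $\hat f$ over $\mathcal X$ is the pointwise smallest concave function on $\mathcal X$ that is $\ge\hat f$ on $\mathcal X$; i.e. a concave function $c:\mathcal X\to\mathbb R$ with $c\ge\hat f$ on $\mathcal X$ such that every concave $\varphi:\mathcal X\to\mathbb R$ with $\varphi\ge\hat f$ on $\mathcal X$ satisfies $\varphi\ge c$ on $\mathcal X$. *)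

theory Defs
  imports "HOL-Analysis.Analysis"
begin

text \<open>
  Layer \<open>k\<close> has width \<open>d k\<close>, and hidden vectors are functions on the indices below \<open>d k\<close>.
  \<open>W k i j\<close> is the \<open>(i, j)\<close> entry of \<open>W\<^sub>k\<close>, \<open>S k i\<close> is the \<open>i\<close>-th row of \<open>S\<^sub>k\<close>.
\<close>

definition icnn_params :: "nat \<Rightarrow> (nat \<Rightarrow> nat) \<Rightarrow> (nat \<Rightarrow> nat \<Rightarrow> nat \<Rightarrow> real) \<Rightarrow>
    (nat \<Rightarrow> nat \<Rightarrow> real ^ 'n) \<Rightarrow> (nat \<Rightarrow> nat \<Rightarrow> real) \<Rightarrow> bool" where
  "icnn_params K d W S b \<longleftrightarrow>
     K \<ge> 1 \<and> d 0 = CARD('n) \<and> d K = 1 \<and>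
     (\<forall>k. 1 \<le> k \<and> k < K \<longrightarrow> (\<forall>i < d (Suc k). \<forall>j < d k. W k i j \<ge> 0))"

text \<open>
  \<open>icnn_pre d W S b x k\<close> is \<open>W\<^sub>k z\<^sub>k + S\<^sub>k z\<^sub>0 + b\<^sub>k\<close> with \<open>z\<^sub>0 = x\<close>.  The convention \<open>W\<^sub>0 = 0\<close>
  is built in by leaving the summand \<open>W\<^sub>0 z\<^sub>0\<close> out, so the entries \<open>W 0 i j\<close> are never read.
  The rectified value \<open>z\<^sub>k\<^sub>+\<^sub>1\<close> appears where the next layer consumes it, hence the last layer
  \<open>k = K - 1\<close> is affine in \<open>z\<^sub>k\<close> and \<open>x\<close>.
\<close>

primrec icnn_pre :: "(nat \<Rightarrow> nat) \<Rightarrow> (nat \<Rightarrow> nat \<Rightarrow> nat \<Rightarrow> real) \<Rightarrow> (nat \<Rightarrow> nat \<Rightarrow> real ^ 'n) \<Rightarrow>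
    (nat \<Rightarrow> nat \<Rightarrow> real) \<Rightarrow> real ^ 'n \<Rightarrow> nat \<Rightarrow> nat \<Rightarrow> real" where
  "icnn_pre d W S b x 0 = (\<lambda>i. S 0 i \<bullet> x + b 0 i)"
| "icnn_pre d W S b x (Suc k) =
     (\<lambda>i. (\<Sum>j < d (Suc k). W (Suc k) i j * max 0 (icnn_pre d W S b x k j))
            + S (Suc k) i \<bullet> x + b (Suc k) i)"

definition icnn :: "nat \<Rightarrow> (nat \<Rightarrow> nat) \<Rightarrow> (nat \<Rightarrow> nat \<Rightarrow> nat \<Rightarrow> real) \<Rightarrow>
    (nat \<Rightarrow> nat \<Rightarrow> real ^ 'n) \<Rightarrow> (nat \<Rightarrow> nat \<Rightarrow> real) \<Rightarrow> real ^ 'n \<Rightarrow> real" where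
  "icnn K d W S b x = icnn_pre d W S b x (K - 1) 0"

definition is_concave_envelope :: "'a::real_vector set \<Rightarrow> ('a \<Rightarrow> real) \<Rightarrow> ('a \<Rightarrow> real) \<Rightarrow> bool" where
  "is_concave_envelope X f c \<longleftrightarrow>
     concave_on X c \<and> (\<forall>x\<in>X. f x \<le> c x) \<and>
     (\<forall>\<phi>. concave_on X \<phi> \<and> (\<forall>x\<in>X. f x \<le> \<phi> x) \<longrightarrow> (\<forall>x\<in>X. c x \<le> \<phi> x))"

text \<open>
  The \<open>2\<^sup>n\<close> choices of bounds are indexed by the set \<open>I\<close> of coordinates at their upper bound.
  If \<open>l $ j = u $ j\<close> for some \<open>j\<close>, the list of vertices has repetitions.
\<close>

definition box_vertex :: "real ^ 'n \<Rightarrow> real ^ 'n \<Rightarrow> 'n set \<Rightarrow> real ^ 'n" where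
  "box_vertex l u I = (\<chi> j. if j \<in> I then u $ j else l $ j)"

definition lp_feasible :: "(real ^ 'n \<Rightarrow> real) \<Rightarrow> real ^ 'n \<Rightarrow> real ^ 'n \<Rightarrow> real ^ 'n \<Rightarrow>
    real ^ ('n set) \<Rightarrow> real \<Rightarrow> bool" where
  "lp_feasible f l u x \<alpha> z \<longleftrightarrow>
     (\<Sum>I\<in>UNIV. \<alpha> $ I *\<^sub>R box_vertex l u I) = x \<and>
     (\<Sum>I\<in>UNIV. \<alpha> $ I) = 1 \<and>
     z = (\<Sum>I\<in>UNIV. \<alpha> $ I * f (box_vertex l u I)) \<and>
     (\<forall>I. \<alpha> $ I \<ge> 0)"

text \<open>Only meaningful where the maximum is attained.\<close>

definition lp_value :: "(real ^ 'n \<Rightarrow> real) \<Rightarrow> real ^ 'n \<Rightarrow> real ^ 'n \<Rightarrow> real ^ 'n \<Rightarrow> real" where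
  "lp_value f l u x = (GREATEST z. \<exists>\<alpha>. lp_feasible f l u x \<alpha> z)"

end

theory Submission
  imports Defs
begin

text \<open>
  Non-negative weights and the monotone convex rectifier preserve convexity, so the network is
  convex in its input.  Weights distributing a point of the box over the vertices are obtained as
  a product measure: with \<open>x\<^sub>j = t\<^sub>j u\<^sub>j + (1 - t\<^sub>j) l\<^sub>j\<close>, the vertex \<open>I\<close> gets the weight
  \<open>\<Prod>\<^bsub>j \<in> I\<^esub> t\<^sub>j \<cdot> \<Prod>\<^bsub>j \<notin> I\<^esub> (1 - t\<^sub>j)\<close>.
  The feasible weights thus form a non-empty compact set, and the maximum is attained.  Mixing
  optimal weights shows concavity of the value function, Jensen's inequality for the network shows
  that it dominates the network, and Jensen's inequality for a concave majorant shows minimality.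
\<close>

lemma convex_on_max:
  assumes "convex_on A f" "convex_on A g"
  shows "convex_on A (\<lambda>x. max (f x) (g x))"
proof (rule convex_onI)
  fix t :: real and x y
  assume t: "0 < t" "t < 1" and xy: "x \<in> A" "y \<in> A"
  have "f ((1 - t) *\<^sub>R x + t *\<^sub>R y) \<le> (1 - t) * f x + t * f y"
       "g ((1 - t) *\<^sub>R x + t *\<^sub>R y) \<le> (1 - t) * g x + t * g y"
    using convex_onD[OF assms(1), of t x y] convex_onD[OF assms(2), of t x y] t xy by auto
  moreover have "(1 - t) * f x + t * f y \<le> (1 - t) * max (f x) (g x) + t * max (f y) (g y)"
       "(1 - t) * g x + t * g y \<le> (1 - t) * max (f x) (g x) + t * max (f y) (g y)"
    using t by (auto intro!: add_mono mult_left_mono)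
  ultimately show "max (f ((1 - t) *\<^sub>R x + t *\<^sub>R y)) (g ((1 - t) *\<^sub>R x + t *\<^sub>R y))
      \<le> (1 - t) * max (f x) (g x) + t * max (f y) (g y)"
    by linarith
qed (use assms convex_on_imp_convex in blast)

lemma convex_on_sum_fun:
  assumes "finite J" "convex A" "\<And>j. j \<in> J \<Longrightarrow> convex_on A (f j)"
  shows "convex_on A (\<lambda>x. \<Sum>j\<in>J. f j x)"
  using assms(1,3)
  by (induction J rule: finite_induct) (auto simp: convex_on_const assms(2))

lemma convex_on_affine: "convex A \<Longrightarrow> convex_on A (\<lambda>x. s \<bullet> x + c)"
proof (rule convex_onI)
  fix t :: real and x y
  show "s \<bullet> ((1 - t) *\<^sub>R x + t *\<^sub>R y) + c \<le> (1 - t) * (s \<bullet> x + c) + t * (s \<bullet> y + c)"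
    by (simp add: algebra_simps)
qed

text \<open>The induction runs over pre-activations because the output layer is not rectified. The
  bounds on \<open>k\<close> and \<open>i\<close> keep every weight that is read inside the range
  where \<open>icnn_params\<close> fixes its sign; layer 0 is affine, so its base case needs no
  sign.\<close>

lemma convex_on_icnn_pre:
  fixes S :: "nat \<Rightarrow> nat \<Rightarrow> real ^ 'n"
  assumes "icnn_params K d W S b" "k < K" "i < d (Suc k)"
  shows "convex_on UNIV (\<lambda>x. icnn_pre d W S b x k i)"
  using assms(2,3)
proof (induction k arbitrary: i)
  case 0
  show ?case by (simp add: convex_on_affine)
next
  case (Suc k)
  have "W (Suc k) i j \<ge> 0" if "j < d (Suc k)" for j
    using assms(1) Suc.prems that by (auto simp: icnn_params_def)
  with Suc have "convex_on UNIV (\<lambda>x. (\<Sum>j < d (Suc k). W (Suc k) i j * max 0 (icnn_pre d W S b x k j))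
            + (S (Suc k) i \<bullet> x + b (Suc k) i))"
    by (intro convex_on_add convex_on_sum_fun convex_on_cmul convex_on_max convex_on_affine)
       (auto simp: convex_on_const)
  then show ?case by (simp add: add.assoc)
qed

lemma convex_on_icnn:
  assumes "icnn_params K d W S b"
  shows "convex_on UNIV (icnn K d W S b)"
proof -
  \<comment> \<open>\<open>K \<ge> 1\<close> gives \<open>Suc (K - 1) = K\<close>, and
    \<open>d K = 1\<close> makes 0 a valid output index.\<close>
  have "K - 1 < K" "0 < d (Suc (K - 1))"
    using assms by (auto simp: icnn_params_def)
  from convex_on_icnn_pre[OF assms this] show ?thesis
    by (simp add: icnn_def[abs_def])
qed

lemma box_vertex_in_cbox:
  assumes "\<And>j. l $ j \<le> u $ j"
  shows "box_vertex l u I \<in> cbox l u"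
  using assms by (auto simp: box_vertex_def mem_box_cart)

lemma lp_feasible_exists:
  fixes l u :: "real ^ 'n"
  assumes x: "x \<in> cbox l u"
  shows "\<exists>\<alpha> z. lp_feasible f l u x \<alpha> z"
proof -
  \<comment> \<open>Segment membership yields \<open>t\<close> without a division, so a degenerate
    side \<open>l $ j = u $ j\<close> is no special case.\<close>
  have "\<exists>t. 0 \<le> t \<and> t \<le> 1 \<and> x $ j = t * u $ j + (1 - t) * l $ j" for j
  proof -
    have "l $ j \<le> x $ j" "x $ j \<le> u $ j" using x by (auto simp: mem_box_cart)
    then have "x $ j \<in> closed_segment (l $ j) (u $ j)"
      by (simp add: closed_segment_eq_real_ivl)
    then show ?thesis
      by (auto simp: closed_segment_def add.commute)
  qed
  then obtain t where t: "\<And>j. 0 \<le> t j" "\<And>j. t j \<le> 1"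
      "\<And>j. x $ j = t j * u $ j + (1 - t j) * l $ j"
    by metis
  define \<alpha> :: "real ^ 'n set" where "\<alpha> = (\<chi> I. prod t I * (\<Prod>j\<in>-I. 1 - t j))"
  have nonneg: "\<alpha> $ I \<ge> 0" for I
    using t by (auto simp: \<alpha>_def intro!: mult_nonneg_nonneg prod_nonneg)
  \<comment> \<open>Multiplying out the product picks \<open>p j\<close> or \<open>q j\<close> for
    each \<open>j\<close>; \<open>I\<close> records where \<open>p\<close> is picked.\<close>
  have expand: "(\<Sum>I\<in>UNIV. prod p I * prod q (-I)) = (\<Prod>j\<in>UNIV. p j + q j)"
    for p q :: "'n \<Rightarrow> real"
    using prod_add[of UNIV p q] by (simp add: Compl_eq_Diff_UNIV)
  have total: "(\<Sum>I\<in>UNIV. \<alpha> $ I) = 1"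
    using expand[of t "\<lambda>j. 1 - t j"] by (simp add: \<alpha>_def)
  have "(\<Sum>I\<in>UNIV. \<alpha> $ I * box_vertex l u I $ j) = x $ j" for j
  proof -
    \<comment> \<open>Coordinate \<open>j\<close> of a vertex depends only on whether
      \<open>j \<in> I\<close>, so it can be absorbed into the factor at \<open>j\<close>. After
      expansion the other factors are \<open>t i + (1 - t i) = 1\<close>.\<close>
    let ?p = "\<lambda>i. t i * (if i = j then u $ j else 1)"
    let ?q = "\<lambda>i. (1 - t i) * (if i = j then l $ j else 1)"
    have "\<alpha> $ I * box_vertex l u I $ j = prod ?p I * prod ?q (-I)" for I
      by (simp add: \<alpha>_def box_vertex_def prod.distrib)
    then have "(\<Sum>I\<in>UNIV. \<alpha> $ I * box_vertex l u I $ j) = (\<Prod>i\<in>UNIV. ?p i + ?q i)"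
      by (simp only: expand)
    also have "\<dots> = (\<Prod>i\<in>UNIV. if i = j then x $ j else 1)"
      by (rule prod.cong) (auto simp: t(3))
    finally show ?thesis by simp
  qed
  then have "(\<Sum>I\<in>UNIV. \<alpha> $ I *\<^sub>R box_vertex l u I) = x"
    by (simp add: vec_eq_iff)
  with nonneg total show ?thesis
    unfolding lp_feasible_def by blast
qed

text \<open>Nothing is known of a \<open>GREATEST\<close> before a maximum is exhibited, so both
  facts come from one maximiser. As \<open>f\<close> enters only through constants, its values at
  the vertices, the objective is linear in the weights and hence continuous for any
  \<open>f\<close>.\<close>

lemma lp_value_optimal:
  fixes l u :: "real ^ 'n"
  assumes x: "x \<in> cbox l u"
  shows lp_value_attained: "\<exists>\<alpha>. lp_feasible f l u x \<alpha> (lp_value f l u x)"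
    and lp_value_upper: "lp_feasible f l u x \<alpha> z \<Longrightarrow> z \<le> lp_value f l u x"
proof -
  define F where "F = {\<alpha>. (\<Sum>I\<in>UNIV. \<alpha> $ I *\<^sub>R box_vertex l u I) = x}
      \<inter> {\<alpha> :: real ^ 'n set. (\<Sum>I\<in>UNIV. \<alpha> $ I) = 1} \<inter> {\<alpha>. \<forall>I. \<alpha> $ I \<ge> 0}"
  define obj where "obj \<alpha> = (\<Sum>I\<in>UNIV. \<alpha> $ I * f (box_vertex l u I))" for \<alpha> :: "real ^ 'n set"
  have feas: "lp_feasible f l u x \<alpha> z \<longleftrightarrow> \<alpha> \<in> F \<and> z = obj \<alpha>" for \<alpha> z
    by (auto simp: lp_feasible_def F_def obj_def)
  \<comment> \<open>Non-negative weights of sum 1 lie in the unit cube, which gives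
    boundedness.\<close>
  have "\<alpha> $ I \<le> 1" if "\<alpha> \<in> F" for \<alpha> I
    using that member_le_sum[of I UNIV "\<lambda>I. \<alpha> $ I"] by (auto simp: F_def)
  then have "F \<subseteq> cbox 0 1"
    by (auto simp: mem_box_cart) (auto simp: F_def)
  moreover have "closed F"
    unfolding F_def
    by (intro closed_Int closed_Collect_eq closed_Collect_all closed_Collect_le continuous_intros)
  ultimately have "compact F"
    using bounded_subset[OF bounded_cbox] by (auto simp: compact_eq_bounded_closed)
  moreover have "F \<noteq> {}"
    using lp_feasible_exists[OF x, of f] feas by blast
  moreover have "continuous_on F obj"
    unfolding obj_def by (intro continuous_intros)
  ultimately obtain \<alpha>' where \<alpha>': "\<alpha>' \<in> F" "\<And>\<alpha>. \<alpha> \<in> F \<Longrightarrow> obj \<alpha> \<le> obj \<alpha>'"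
    using continuous_attains_sup by metis
  then have "lp_value f l u x = obj \<alpha>'"
    unfolding lp_value_def by (intro Greatest_equality) (auto simp: feas)
  with \<alpha>' show "\<exists>\<alpha>. lp_feasible f l u x \<alpha> (lp_value f l u x)"
    and "lp_feasible f l u x \<alpha> z \<Longrightarrow> z \<le> lp_value f l u x"
    by (auto simp: feas)
qed

text \<open>The constraints are linear equations and sign conditions, jointly in the point, the
  weights and the value.\<close>

lemma lp_feasible_combine:
  assumes "lp_feasible f l u x \<alpha> z" "lp_feasible f l u y \<beta> w"
    and "0 \<le> s" "0 \<le> t" "s + t = 1"
  shows "lp_feasible f l u (s *\<^sub>R x + t *\<^sub>R y) (s *\<^sub>R \<alpha> + t *\<^sub>R \<beta>) (s * z + t * w)"
proof -
  have "(\<Sum>I\<in>UNIV. (s *\<^sub>R \<alpha> + t *\<^sub>R \<beta>) $ I *\<^sub>R box_vertex l u I) =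
      s *\<^sub>R (\<Sum>I\<in>UNIV. \<alpha> $ I *\<^sub>R box_vertex l u I) + t *\<^sub>R (\<Sum>I\<in>UNIV. \<beta> $ I *\<^sub>R box_vertex l u I)"
    by (simp add: scaleR_sum_right sum.distrib scaleR_add_left)
  \<comment> \<open>A general \<open>g\<close> serves both the normalisation and the
    objective.\<close>
  moreover have "(\<Sum>I\<in>UNIV. (s *\<^sub>R \<alpha> + t *\<^sub>R \<beta>) $ I * g I) =
      s * (\<Sum>I\<in>UNIV. \<alpha> $ I * g I) + t * (\<Sum>I\<in>UNIV. \<beta> $ I * g I)" for g
    by (simp add: sum_distrib_left sum.distrib distrib_right mult.assoc)
  note this[of "\<lambda>_. 1"] this[of "\<lambda>I. f (box_vertex l u I)"]
  ultimately show ?thesis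
    using assms unfolding lp_feasible_def by simp
qed

lemma concave_on_lp_value: "concave_on (cbox l u) (lp_value f l u)"
  unfolding concave_on_iff
proof (intro conjI ballI allI impI)
  fix x y and s t :: real
  assume xy: "x \<in> cbox l u" "y \<in> cbox l u" and st: "0 \<le> s" "0 \<le> t" "s + t = 1"
  obtain \<alpha> \<beta> where "lp_feasible f l u x \<alpha> (lp_value f l u x)" "lp_feasible f l u y \<beta> (lp_value f l u y)"
    using lp_value_attained xy by blast
  note lp_feasible_combine[OF this st]
  moreover have "s *\<^sub>R x + t *\<^sub>R y \<in> cbox l u"
    using convexD[OF convex_box(1)] xy st by blast
  ultimately show "s * lp_value f l u x + t * lp_value f l u y \<le> lp_value f l u (s *\<^sub>R x + t *\<^sub>R y)"
    using lp_value_upper by blast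
qed simp

lemma convex_le_lp_feasible:
  assumes "\<And>j. l $ j \<le> u $ j" "convex_on (cbox l u) f" "lp_feasible f l u x \<alpha> z"
  shows "f x \<le> z"
  using convex_on_sum[OF _ _ assms(2), of UNIV "\<lambda>I. \<alpha> $ I" "box_vertex l u"] assms(3)
  by (auto simp: lp_feasible_def box_vertex_in_cbox[OF assms(1)])

text \<open>The majorant is compared with \<open>f\<close> at the vertices only; concavity then
  carries the bound to their barycentre \<open>x\<close>.\<close>

lemma lp_feasible_le_concave:
  assumes "\<And>j. l $ j \<le> u $ j" "concave_on (cbox l u) \<phi>" "\<And>y. y \<in> cbox l u \<Longrightarrow> f y \<le> \<phi> y"
    and feas: "lp_feasible f l u x \<alpha> z"
  shows "z \<le> \<phi> x"
proof -
  have "z = (\<Sum>I\<in>UNIV. \<alpha> $ I * f (box_vertex l u I))"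
    using feas by (simp add: lp_feasible_def)
  also have "\<dots> \<le> (\<Sum>I\<in>UNIV. \<alpha> $ I * \<phi> (box_vertex l u I))"
    using feas assms(3) box_vertex_in_cbox[OF assms(1)]
    by (intro sum_mono mult_left_mono) (auto simp: lp_feasible_def)
  also have "\<dots> \<le> \<phi> (\<Sum>I\<in>UNIV. \<alpha> $ I *\<^sub>R box_vertex l u I)"
    using feas box_vertex_in_cbox[OF assms(1)]
    by (intro concave_on_sum[OF _ _ assms(2)]) (auto simp: lp_feasible_def)
  finally show ?thesis
    using feas by (simp add: lp_feasible_def)
qed

theorem proposition2:
  fixes l u :: "real ^ 'n"
    and K :: nat
    and d :: "nat \<Rightarrow> nat"
    and W :: "nat \<Rightarrow> nat \<Rightarrow> nat \<Rightarrow> real"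
    and S :: "nat \<Rightarrow> nat \<Rightarrow> real ^ 'n"
    and b :: "nat \<Rightarrow> nat \<Rightarrow> real"
    and f :: "real ^ 'n \<Rightarrow> real"
  assumes bounds: "\<And>j. l $ j \<le> u $ j"
    and params: "icnn_params K d W S b"
    and f: "\<And>x. x \<in> cbox l u \<Longrightarrow> f x = icnn K d W S b x"
  shows "(\<forall>x \<in> cbox l u.
            (\<exists>\<alpha>. lp_feasible f l u x \<alpha> (lp_value f l u x)) \<and>
            (\<forall>\<alpha> z. lp_feasible f l u x \<alpha> z \<longrightarrow> z \<le> lp_value f l u x)) \<and>
         is_concave_envelope (cbox l u) f (lp_value f l u)"
proof -
  have "convex_on (cbox l u) (icnn K d W S b)"
    using convex_on_subset[OF convex_on_icnn[OF params]] by simp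
  \<comment> \<open>\<open>f\<close> is known only on the box, so the transfer uses that convex
    combinations stay in it.\<close>
  then have conv: "convex_on (cbox l u) f"
    using f convexD[OF convex_box(1)[of l u]] by (simp add: convex_on_def)
  have "f x \<le> lp_value f l u x" if "x \<in> cbox l u" for x
    using lp_value_attained[OF that] convex_le_lp_feasible[OF bounds conv] by blast
  moreover have "lp_value f l u x \<le> \<phi> x"
    if "concave_on (cbox l u) \<phi>" "\<forall>x\<in>cbox l u. f x \<le> \<phi> x" "x \<in> cbox l u" for \<phi> x
    using lp_value_attained[OF that(3)] lp_feasible_le_concave[OF bounds that(1)] that(2) by blast
  ultimately have "is_concave_envelope (cbox l u) f (lp_value f l u)"
    by (simp add: is_concave_envelope_def concave_on_lp_value)
  then show ?thesis
    by (simp add: lp_value_attained lp_value_upper)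
qed

end
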